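(* Let $\{\delta_k\}$ be a sequence of positive scalars and $\{\epsilon^k\}$ a sequence of positive vectors in $\mathbb{R}^n$ such that $\delta_k\to0$ and $\epsilon^k\to0$. Suppose that $\{x^k\}$ is a sequence of vectors generated by the first type of $\mathrm{IRL}_\alpha$ minimization method or its variant (described in the context), that is, for each $k$, $x^k$ is found by applying the $\mathrm{IRL}_\alpha$ method or its variant to the problem $\min_x F_{\alpha,\epsilon^k}(x)$ and satisfies $$\left\|X^k\nabla f(x^k)+\lambda p|X^k|^\alpha(|x^k|^\alpha+\epsilon^k)^{\frac p\alpha-1}\right\|\le\delta_k ,$$ where $X^k=\mathrm{Diag}(x^k)$ and $|X^k|^\alpha=\mathrm{Diag}(|x^k|^\alpha)$. Suppose that $x^*$ is an accumulation point of $\{x^k\}$. Then $x^*$ is a first-order stationary point of $\min_{x\in\mathbb{R}^n}\{F(x)=f(x)+\lambda\|x\|_p^p\}$, i.e., $X^*\nabla f(x^* )+\lambda p|x^*|^p=0$ with $X^*=\mathrm{Diag}(x^* )$.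
   Context: Here $\lambda>0$, $p\in(0,1)$, $\alpha\ge1$, and $f:\mathbb{R}^n\to\mathbb{R}$ is continuously differentiable, bounded below, with $L_f$-Lipschitz continuous gradient. $\|x\|_p^p=\sum_i|x_i|^p$. Powers and absolute values of vectors are taken componentwise; $\mathrm{Diag}(x)$ is the diagonal matrix with diagonal $x$. For a positive vector $\epsilon\in\mathbb{R}^n$, $F_{\alpha,\epsilon}(x):=f(x)+\lambda\sum_{i=1}^n(|x_i|^\alpha+\epsilon_i)^{p/\alpha}$. The $\mathrm{IRL}_\alpha$ method applied to $\min_xF_{\alpha,\epsilon}(x)$: start from an arbitrary point $y^0$ and for $j=0,1,\dots$ let $y^{j+1}\in\mathrm{Arg\,min}_x\{f(x)+\frac{\lambda p}{\alpha}\sum_{i=1}^n s^j_i|x_i|^\alpha\}$, where $s^j_i=(|y^j_i|^\alpha+\epsilon_i)^{\frac p\alpha-1}$. Its variant: given $0<L_{\min}<L_{\max}$, $\tau>1$, $c>0$, and an arbitrary $y^0$, for $j=0,1,\dots$ choose $L^0_j\in[L_{\min},L_{\max}]$ arbitrarily, set $L_j=L^0_j$, and repeat: compute $y^{j+1}\in\mathrm{Arg\,min}_x\{f(y^j)+\nabla f(y^j)^T(x-y^j)+\frac{L_j}{2}\|x-y^j\|_2^2+\frac{\lambda p}{\alpha}\sum_i s^j_i|x_i|^\alpha\}$ with the same $s^j$; if $F_{\alpha,\epsilon}(y^j)-F_{\alpha,\epsilon}(y^{j+1})\ge\frac c2\|y^{j+1}-y^j\|_2^2$ accept $y^{j+1}$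 and pass to $j+1$, otherwise replace $L_j$ by $\tau L_j$ and repeat. The first type of $\mathrm{IRL}_\alpha$ method (or its variant) for $\min F$: for each $k$, apply the $\mathrm{IRL}_\alpha$ method (or its variant) to $\min_xF_{\alpha,\epsilon^k}(x)$ to find an iterate $x^k$ satisfying the displayed inequality of the claim. *)

theory Defs
  imports "HOL-Analysis.Analysis"
begin

definition Diag :: "real ^ 'n \<Rightarrow> real ^ 'n ^ 'n" where
  "Diag x = (\<chi> i j. if i = j then x $ i else 0)"

definition vabs :: "real ^ 'n \<Rightarrow> real ^ 'n" where
  "vabs x = (\<chi> i. \<bar>x $ i\<bar>)"

text \<open>Componentwise real power. It is only applied to nonnegative vectors; a zero entry is
  raised only to a positive exponent, where \<open>0 powr a = 0\<close> is the intended value.\<close>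

definition vpowr :: "real ^ 'n \<Rightarrow> real \<Rightarrow> real ^ 'n" where
  "vpowr x a = (\<chi> i. (x $ i) powr a)"

definition grad :: "(real ^ 'n \<Rightarrow> real) \<Rightarrow> real ^ 'n \<Rightarrow> real ^ 'n" where
  "grad f x = (THE D. GDERIV f x :> D)"

definition F_smooth ::
  "(real ^ 'n \<Rightarrow> real) \<Rightarrow> real \<Rightarrow> real \<Rightarrow> real \<Rightarrow> real ^ 'n \<Rightarrow> real ^ 'n \<Rightarrow> real" where
  "F_smooth f lam p \<alpha> \<epsilon> x =
     f x + lam * (\<Sum>i\<in>UNIV. (\<bar>x $ i\<bar> powr \<alpha> + \<epsilon> $ i) powr (p / \<alpha>))"

definition weighted_penalty ::
  "real \<Rightarrow> real \<Rightarrow> real \<Rightarrow> real ^ 'n \<Rightarrow> real ^ 'n \<Rightarrow> real ^ 'n \<Rightarrow> real" where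
  "weighted_penalty lam p \<alpha> \<epsilon> y x =
     lam * p / \<alpha> *
       (\<Sum>i\<in>UNIV. (\<bar>y $ i\<bar> powr \<alpha> + \<epsilon> $ i) powr (p / \<alpha> - 1) * \<bar>x $ i\<bar> powr \<alpha>)"

definition irl_run ::
  "(real ^ 'n \<Rightarrow> real) \<Rightarrow> real \<Rightarrow> real \<Rightarrow> real \<Rightarrow> real ^ 'n \<Rightarrow> (nat \<Rightarrow> real ^ 'n) \<Rightarrow> bool" where
  "irl_run f lam p \<alpha> \<epsilon> y \<longleftrightarrow>
     (\<forall>j. is_arg_min (\<lambda>x. f x + weighted_penalty lam p \<alpha> \<epsilon> (y j) x) (\<lambda>x. True) (y (Suc j)))"

definition prox_model ::
  "(real ^ 'n \<Rightarrow> real) \<Rightarrow> real \<Rightarrow> real \<Rightarrow> real \<Rightarrow> real ^ 'n \<Rightarrow> real \<Rightarrow> real ^ 'n \<Rightarrow> real ^ 'n \<Rightarrow> real" where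
  "prox_model f lam p \<alpha> \<epsilon> L y x =
     f y + grad f y \<bullet> (x - y) + L / 2 * (norm (x - y))\<^sup>2 + weighted_penalty lam p \<alpha> \<epsilon> y x"

definition sufficient_decrease ::
  "(real ^ 'n \<Rightarrow> real) \<Rightarrow> real \<Rightarrow> real \<Rightarrow> real \<Rightarrow> real ^ 'n \<Rightarrow> real \<Rightarrow> real ^ 'n \<Rightarrow> real ^ 'n \<Rightarrow> bool" where
  "sufficient_decrease f lam p \<alpha> \<epsilon> c y z \<longleftrightarrow>
     F_smooth f lam p \<alpha> \<epsilon> y - F_smooth f lam p \<alpha> \<epsilon> z \<ge> c / 2 * (norm (z - y))\<^sup>2"

text \<open>One outer step of the variant, including its inner loop: \<open>m\<close> is the number of
  rejected trial points and \<open>z i\<close> is the trial point computed with \<open>L\<^sub>j = \<tau> ^ i * L0\<close>.\<close>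

definition irl_variant_step ::
  "(real ^ 'n \<Rightarrow> real) \<Rightarrow> real \<Rightarrow> real \<Rightarrow> real \<Rightarrow> real ^ 'n \<Rightarrow>
   real \<Rightarrow> real \<Rightarrow> real \<Rightarrow> real \<Rightarrow> real ^ 'n \<Rightarrow> real ^ 'n \<Rightarrow> bool" where
  "irl_variant_step f lam p \<alpha> \<epsilon> Lmin Lmax \<tau> c y y' \<longleftrightarrow>
     (\<exists>L0 m z. L0 \<in> {Lmin..Lmax} \<and>
        (\<forall>i\<le>m. is_arg_min (prox_model f lam p \<alpha> \<epsilon> (\<tau> ^ i * L0) y) (\<lambda>x. True) (z i)) \<and>
        (\<forall>i<m. \<not> sufficient_decrease f lam p \<alpha> \<epsilon> c y (z i)) \<and>
        sufficient_decrease f lam p \<alpha> \<epsilon> c y (z m) \<and>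
        y' = z m)"

definition irl_variant_run ::
  "(real ^ 'n \<Rightarrow> real) \<Rightarrow> real \<Rightarrow> real \<Rightarrow> real \<Rightarrow> real ^ 'n \<Rightarrow>
   real \<Rightarrow> real \<Rightarrow> real \<Rightarrow> real \<Rightarrow> (nat \<Rightarrow> real ^ 'n) \<Rightarrow> bool" where
  "irl_variant_run f lam p \<alpha> \<epsilon> Lmin Lmax \<tau> c y \<longleftrightarrow>
     (\<forall>j. irl_variant_step f lam p \<alpha> \<epsilon> Lmin Lmax \<tau> c (y j) (y (Suc j)))"

text \<open>First-order stationarity for minimizing \<open>f x + lam * (\<Sum>i\<in>UNIV. \<bar>x $ i\<bar> powr p)\<close>.\<close>

definition first_order_stationary ::
  "(real ^ 'n \<Rightarrow> real) \<Rightarrow> real \<Rightarrow> real \<Rightarrow> real ^ 'n \<Rightarrow> bool" where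
  "first_order_stationary f lam p x \<longleftrightarrow>
     Diag x *v grad f x + (lam * p) *\<^sub>R vpowr (vabs x) p = 0"

definition accumulation_point :: "(nat \<Rightarrow> 'a::topological_space) \<Rightarrow> 'a \<Rightarrow> bool" where
  "accumulation_point X l \<longleftrightarrow> (\<exists>r. strict_mono r \<and> (X \<circ> r) \<longlonglongrightarrow> l)"

end

theory Submission
  imports Defs
begin

text \<open>The matrix equation decouples into one scalar equation per component, since
  \<open>Diag\<close> acts by componentwise multiplication (\<open>Diag_mult_nth\<close>). Along a
  subsequence converging to \<open>xs\<close>, the residual bounded by \<delta> tends to 0, and
  \<open>grad f\<close> converges by continuity. Where \<open>xs $ i\<close> is nonzero, the
  smoothed term tends to \<open>\<bar>xs $ i\<bar> powr p\<close> as \<epsilon> vanishes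
  (\<open>tendsto_smoothed_power\<close>), so uniqueness of limits gives the equation. Where it is
  zero, the equation is trivial.\<close>

lemma Diag_mult_nth: "(Diag v *v w) $ i = v $ i * w $ i" for v w :: "real ^ 'n"
  by (simp add: Diag_def matrix_vector_mult_def if_distrib[of "\<lambda>t. t * _"] cong: if_cong)

text \<open>Only the case \<open>l \<noteq> 0\<close> is needed: a vanishing component of \<open>xs\<close> satisfies its stationarity
  equation trivially.\<close>

lemma tendsto_smoothed_power:
  fixes X e :: "'a \<Rightarrow> real"
  assumes "(X \<longlongrightarrow> l) F" "(e \<longlongrightarrow> 0) F" "l \<noteq> 0" "\<alpha> > 0"
  shows "((\<lambda>k. \<bar>X k\<bar> powr \<alpha> * (\<bar>X k\<bar> powr \<alpha> + e k) powr (p / \<alpha> - 1)) \<longlongrightarrow> \<bar>l\<bar> powr p) F"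
proof -
  have a: "((\<lambda>k. \<bar>X k\<bar> powr \<alpha>) \<longlongrightarrow> \<bar>l\<bar> powr \<alpha>) F"
    using assms by (intro tendsto_intros) auto
  \<comment> \<open>The exponent \<open>p / \<alpha> - 1\<close> may be negative, so continuity of
    \<open>powr\<close> at the limit base \<open>\<bar>l\<bar> powr \<alpha>\<close> relies on that
    base being nonzero.\<close>
  have "((\<lambda>k. \<bar>X k\<bar> powr \<alpha> * (\<bar>X k\<bar> powr \<alpha> + e k) powr (p / \<alpha> - 1)) \<longlongrightarrow>
      \<bar>l\<bar> powr \<alpha> * (\<bar>l\<bar> powr \<alpha> + 0) powr (p / \<alpha> - 1)) F"
    using assms by (intro tendsto_intros a) auto
  also have "\<bar>l\<bar> powr \<alpha> * (\<bar>l\<bar> powr \<alpha> + 0) powr (p / \<alpha> - 1) = \<bar>l\<bar> powr p"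
    using assms by (simp add: powr_powr powr_add[symmetric] field_simps)
  finally show ?thesis .
qed

theorem theorem3p5:
  fixes f :: "real ^ 'n \<Rightarrow> real"
    and lam p \<alpha> Lf Lmin Lmax \<tau> c :: real
    and \<delta> :: "nat \<Rightarrow> real"
    and \<epsilon> x :: "nat \<Rightarrow> real ^ 'n"
    and xs :: "real ^ 'n"
  assumes "lam > 0" and "0 < p" and "p < 1" and "\<alpha> \<ge> 1"
    and "\<And>u. f differentiable (at u)"
    and "continuous_on UNIV (grad f)"
    and "bdd_below (range f)"
    and "Lf-lipschitz_on UNIV (grad f)"
    and "0 < Lmin" and "Lmin < Lmax" and "\<tau> > 1" and "c > 0"
    and "\<And>k. \<delta> k > 0"
    and "\<And>k i. \<epsilon> k $ i > 0"
    and "\<delta> \<longlonglongrightarrow> 0" and "\<epsilon> \<longlonglongrightarrow> 0"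
    and "\<And>k. \<exists>y j. (irl_run f lam p \<alpha> (\<epsilon> k) y \<or>
                    irl_variant_run f lam p \<alpha> (\<epsilon> k) Lmin Lmax \<tau> c y) \<and> x k = y j"
    and "\<And>k. norm (Diag (x k) *v grad f (x k) +
               (lam * p) *\<^sub>R (Diag (vpowr (vabs (x k)) \<alpha>) *v
                  vpowr (vpowr (vabs (x k)) \<alpha> + \<epsilon> k) (p / \<alpha> - 1))) \<le> \<delta> k"
    and "accumulation_point x xs"
  shows "first_order_stationary f lam p xs"
proof -
  define V where "V k = Diag (x k) *v grad f (x k) +
    (lam * p) *\<^sub>R (Diag (vpowr (vabs (x k)) \<alpha>) *v
      vpowr (vpowr (vabs (x k)) \<alpha> + \<epsilon> k) (p / \<alpha> - 1))" for k
  have V_nth: "V k $ i = x k $ i * grad f (x k) $ i +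
      lam * p * (\<bar>x k $ i\<bar> powr \<alpha> * (\<bar>x k $ i\<bar> powr \<alpha> + \<epsilon> k $ i) powr (p / \<alpha> - 1))" for k i
    by (simp add: V_def Diag_mult_nth vpowr_def vabs_def)
  \<comment> \<open>Squeeze: the termination inequality says exactly that the norm of
    \<open>V k\<close> is at most \<open>\<delta> k\<close>.\<close>
  have V0: "V \<longlonglongrightarrow> 0"
    using assms(18) by (intro Lim_null_comparison[OF _ \<open>\<delta> \<longlonglongrightarrow> 0\<close>]) (simp add: V_def)
  obtain r where r: "strict_mono r" "(\<lambda>k. x (r k)) \<longlonglongrightarrow> xs"
    using \<open>accumulation_point x xs\<close> by (auto simp: accumulation_point_def o_def)
  have g: "(\<lambda>k. grad f (x (r k))) \<longlonglongrightarrow> grad f xs"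
    using continuous_on_tendsto_compose[OF \<open>continuous_on UNIV (grad f)\<close> r(2)] by simp
  have Vr: "(\<lambda>k. V (r k)) \<longlonglongrightarrow> 0" and er: "(\<lambda>k. \<epsilon> (r k)) \<longlonglongrightarrow> 0"
    using LIMSEQ_subseq_LIMSEQ[OF V0 r(1)] LIMSEQ_subseq_LIMSEQ[OF \<open>\<epsilon> \<longlonglongrightarrow> 0\<close> r(1)]
    by (simp_all add: o_def)
  have "xs $ i * grad f xs $ i + lam * p * \<bar>xs $ i\<bar> powr p = 0" for i
  \<comment> \<open>A zero component needs no limit: both terms vanish because
    \<open>0 powr p = 0\<close>, which the closing \<open>simp\<close> uses. This avoids a negative
    power whose base tends to 0.\<close>
  proof (cases "xs $ i = 0")
    case False
    have "(\<lambda>k. V (r k) $ i) \<longlonglongrightarrow> xs $ i * grad f xs $ i + lam * p * \<bar>xs $ i\<bar> powr p"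
      unfolding V_nth
      using False \<open>\<alpha> \<ge> 1\<close> tendsto_vec_nth[OF er, of i]
      by (intro tendsto_add tendsto_mult tendsto_const tendsto_smoothed_power
          tendsto_vec_nth r(2) g) auto
    moreover have "(\<lambda>k. V (r k) $ i) \<longlonglongrightarrow> 0"
      using tendsto_vec_nth[OF Vr, of i] by simp
    ultimately show ?thesis
      by (rule LIMSEQ_unique)
  qed simp
  then show ?thesis
    by (simp add: first_order_stationary_def vec_eq_iff Diag_mult_nth vpowr_def vabs_def)
qed

end
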